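(* Let $k\ge 2$, let $p_1,\ldots,p_k\ge 2$ be integers, and let $W = C_{p_k}\wr \cdots \wr C_{p_1}$. Then $cw(W)=1$.
   Context: $C_p$ is the cyclic group of order $p$ generated by the cycle $(1,2,\ldots,p)$ and acting naturally (by shift) on $\{1,\ldots,p\}$. For a group $H$ and a group $G$ acting by permutations on a set $X$, $H\wr G$ is the permutational wreath product, the semidirect product of $H^X$ with $G$, where $G$ permutes the direct factors; the rightmost group is the active (top) one. The iterated permutational wreath product is associative, so $W=(C_{p_k}\wr\cdots\wr C_{p_2})\wr C_{p_1}$. Notation: $[a,b]=aba^{-1}b^{-1}$, and $G'=[G,G]$. The commutator length of $g\in G'$ is the minimal $n$ such that $g$ is a product of $n$ commutators of elements of $G$ (the identity has length $0$). The commutator width $cw(G)$ is the maximum of the commutator lengths of the elements of $G'$. *)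

theory Defs
  imports
    "HOL-Algebra.Product_Groups"
    "HOL-Algebra.Sym_Groups"
    "HOL-Algebra.Weak_Morphisms"
    "HOL-Library.Extended_Nat"
begin

text \<open>For a left action \<open>\<phi>\<close> of \<open>G\<close> on \<open>X\<close>, an element \<open>g\<close> of \<open>G\<close> moves the factor of \<open>H\<^sup>X\<close>
  at \<open>x\<close> to the factor at \<open>\<phi> g x\<close>, hence the inverse in the index below.\<close>

definition permute_factors ::
  "('g, 'm) monoid_scheme \<Rightarrow> 'x set \<Rightarrow> ('g \<Rightarrow> 'x \<Rightarrow> 'x) \<Rightarrow> 'g \<Rightarrow> ('x \<Rightarrow> 'h) \<Rightarrow> 'x \<Rightarrow> 'h"
  where "permute_factors G X \<phi> g f = (\<lambda>x\<in>X. f (\<phi> (inv\<^bsub>G\<^esub> g) x))"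

definition wreath_product ::
  "('h, 'n) monoid_scheme \<Rightarrow> ('g, 'm) monoid_scheme \<Rightarrow> 'x set \<Rightarrow> ('g \<Rightarrow> 'x \<Rightarrow> 'x)
     \<Rightarrow> (('x \<Rightarrow> 'h) \<times> 'g) monoid"
  where "wreath_product H G X \<phi> =
    \<lparr>carrier = carrier (product_group X (\<lambda>_. H)) \<times> carrier G,
     monoid.mult = (\<lambda>(f1, g1) (f2, g2).
       (f1 \<otimes>\<^bsub>product_group X (\<lambda>_. H)\<^esub> permute_factors G X \<phi> g1 f2, g1 \<otimes>\<^bsub>G\<^esub> g2)),
     one = (\<one>\<^bsub>product_group X (\<lambda>_. H)\<^esub>, \<one>\<^bsub>G\<^esub>)\<rparr>"

definition cyclic_perm_group :: "nat \<Rightarrow> (nat \<Rightarrow> nat) monoid"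
  where "cyclic_perm_group p =
    subgroup_generated (sym_group p) {cycle_of_list [1..<Suc p]}"

text \<open>The number of nested function spaces in an iterated wreath product depends on the number
  of factors. The datatype below provides a single type for all of them; the injective
  constructors only serve to transport the group structures.\<close>

datatype wreath_elem =
    Base "nat \<Rightarrow> nat"
  | Node "(nat \<Rightarrow> wreath_elem) \<times> (nat \<Rightarrow> nat)"

text \<open>\<open>iter_wreath [p\<^sub>1, \<dots>, p\<^sub>k]\<close> is the group
  \<open>(C\<^bsub>p\<^sub>k\<^esub> \<wr> \<dots> \<wr> C\<^bsub>p\<^sub>2\<^esub>) \<wr> C\<^bsub>p\<^sub>1\<^esub>\<close>: the head of the list is the
  active factor. The empty list yields a trivial group by convention.\<close>

fun iter_wreath :: "nat list \<Rightarrow> wreath_elem monoid"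
  where
    "iter_wreath [] = image_group Base (sym_group 0)"
  | "iter_wreath [p] = image_group Base (cyclic_perm_group p)"
  | "iter_wreath (p # q # ps) = image_group Node
       (wreath_product (iter_wreath (q # ps)) (cyclic_perm_group p) {1..p} (\<lambda>\<sigma>. \<sigma>))"

text \<open>Only meaningful for elements of the derived subgroup. An element of
  \<open>derived_set G (carrier G)\<close> is a commutator \<open>a b a\<^sup>-\<^sup>1 b\<^sup>-\<^sup>1\<close>.\<close>

definition commutator_length :: "('a, 'b) monoid_scheme \<Rightarrow> 'a \<Rightarrow> nat"
  where "commutator_length G g =
    (LEAST n. \<exists>cs. length cs = n \<and> set cs \<subseteq> derived_set G (carrier G)
                 \<and> g = foldr (\<lambda>x y. x \<otimes>\<^bsub>G\<^esub> y) cs \<one>\<^bsub>G\<^esub>)"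

text \<open>The value is \<open>\<infinity>\<close> if the commutator lengths are unbounded; a finite supremum is attained
  and is therefore a maximum.\<close>

definition commutator_width :: "('a, 'b) monoid_scheme \<Rightarrow> enat"
  where "commutator_width G =
    (SUP g\<in>derived G (carrier G). enat (commutator_length G g))"


lemma group_wreath_product:
  assumes H: "group H" and G: "group G"
    and closed: "\<And>g x. g \<in> carrier G \<Longrightarrow> x \<in> X \<Longrightarrow> \<phi> g x \<in> X"
    and act_one: "\<And>x. x \<in> X \<Longrightarrow> \<phi> \<one>\<^bsub>G\<^esub> x = x"
    and act_mult: "\<And>g h x. g \<in> carrier G \<Longrightarrow> h \<in> carrier G \<Longrightarrow> x \<in> X
                     \<Longrightarrow> \<phi> (g \<otimes>\<^bsub>G\<^esub> h) x = \<phi> g (\<phi> h x)"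
  shows "group (wreath_product H G X \<phi>)"
proof -
  interpret H: group H by fact
  interpret G: group G by fact
  show ?thesis
  proof (rule groupI)
    fix u v assume "u \<in> carrier (wreath_product H G X \<phi>)" "v \<in> carrier (wreath_product H G X \<phi>)"
    then show "u \<otimes>\<^bsub>wreath_product H G X \<phi>\<^esub> v \<in> carrier (wreath_product H G X \<phi>)"
      by (auto simp: wreath_product_def permute_factors_def PiE_iff closed)
  next
    show "\<one>\<^bsub>wreath_product H G X \<phi>\<^esub> \<in> carrier (wreath_product H G X \<phi>)"
      by (auto simp: wreath_product_def)
  next
    fix u v w
    assume "u \<in> carrier (wreath_product H G X \<phi>)" "v \<in> carrier (wreath_product H G X \<phi>)"
      "w \<in> carrier (wreath_product H G X \<phi>)"
    then show "u \<otimes>\<^bsub>wreath_product H G X \<phi>\<^esub> v \<otimes>\<^bsub>wreath_product H G X \<phi>\<^esub> w =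
      u \<otimes>\<^bsub>wreath_product H G X \<phi>\<^esub> (v \<otimes>\<^bsub>wreath_product H G X \<phi>\<^esub> w)"
      by (auto simp: wreath_product_def permute_factors_def PiE_iff closed act_mult
          H.m_assoc G.m_assoc G.inv_mult_group fun_eq_iff)
  next
    fix u assume "u \<in> carrier (wreath_product H G X \<phi>)"
    then show "\<one>\<^bsub>wreath_product H G X \<phi>\<^esub> \<otimes>\<^bsub>wreath_product H G X \<phi>\<^esub> u = u"
      by (auto simp: wreath_product_def permute_factors_def PiE_iff closed act_one
          fun_eq_iff extensional_def)
  next
    fix u assume u: "u \<in> carrier (wreath_product H G X \<phi>)"
    then obtain f g where fg: "u = (f, g)" "f \<in> X \<rightarrow>\<^sub>E carrier H" "g \<in> carrier G"
      by (auto simp: wreath_product_def)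
    let ?v = "(\<lambda>x\<in>X. inv\<^bsub>H\<^esub> f (\<phi> g x), inv\<^bsub>G\<^esub> g)"
    have "?v \<in> carrier (wreath_product H G X \<phi>)"
      using fg by (auto simp: wreath_product_def PiE_iff closed)
    moreover have "?v \<otimes>\<^bsub>wreath_product H G X \<phi>\<^esub> u = \<one>\<^bsub>wreath_product H G X \<phi>\<^esub>"
      using fg by (auto simp: wreath_product_def permute_factors_def PiE_iff closed fun_eq_iff)
    ultimately show "\<exists>v\<in>carrier (wreath_product H G X \<phi>).
      v \<otimes>\<^bsub>wreath_product H G X \<phi>\<^esub> u = \<one>\<^bsub>wreath_product H G X \<phi>\<^esub>" by blast
  qed
qed

lemma cycle_apply:
  assumes "1 \<le> x" "x \<le> p"
  shows "cycle_of_list [1..<Suc p] x = (if x = p then 1 else Suc x)"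
proof -
  have "map (cycle_of_list [1..<Suc p]) [1..<Suc p] = rotate1 [1..<Suc p]"
    using cyclic_rotation[of "[1..<Suc p]" 1] by simp
  then have "map (cycle_of_list [1..<Suc p]) [1..<Suc p] ! (x - 1) = rotate1 [1..<Suc p] ! (x - 1)"
    by (rule arg_cong)
  with assms show ?thesis
    by (auto simp: nth_rotate1 simp del: upt_Suc)
qed

lemma group_cyclic_perm_group: "group (cyclic_perm_group p)"
  unfolding cyclic_perm_group_def by (rule group.group_subgroup_generated[OF sym_group_is_group])

lemma cyclic_perm_group_permutes:
  "\<sigma> \<in> carrier (cyclic_perm_group p) \<Longrightarrow> \<sigma> permutes {1..p}"
  using group.carrier_subgroup_generated_subset[OF sym_group_is_group]
  by (auto simp: cyclic_perm_group_def sym_group_def)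

lemma cyclic_perm_group_mult: "\<sigma> \<otimes>\<^bsub>cyclic_perm_group p\<^esub> \<tau> = \<sigma> \<circ> \<tau>"
  by (simp add: cyclic_perm_group_def sym_group_def subgroup_generated_def)

lemma cyclic_perm_group_one: "\<one>\<^bsub>cyclic_perm_group p\<^esub> = id"
  by (simp add: cyclic_perm_group_def sym_group_def subgroup_generated_def)

lemma group_image_group:
  assumes "group G" "inj f"
  shows "group (image_group f G)"
proof -
  have "f \<in> iso G (image_group f G)"
    using assms(2) by (intro inj_imp_image_group_iso) (auto intro: inj_on_subset)
  then have "group ((image_group f G)\<lparr>one := f \<one>\<^bsub>G\<^esub>\<rparr>)"
    using group.iso_imp_img_group[OF assms(1)] by blast
  then show ?thesis
    by (simp add: image_group_def)
qed

lemma group_wreath_product_cyclic: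
  "group H \<Longrightarrow> group (wreath_product H (cyclic_perm_group p) {1..p} (\<lambda>\<sigma>. \<sigma>))"
proof (rule group_wreath_product)
  show "\<sigma> x \<in> {1..p}" if "\<sigma> \<in> carrier (cyclic_perm_group p)" "x \<in> {1..p}" for \<sigma> x
    using cyclic_perm_group_permutes[OF that(1)] that(2) by (simp only: permutes_in_image)
qed (simp_all add: group_cyclic_perm_group cyclic_perm_group_mult cyclic_perm_group_one)

lemma group_iter_wreath: "group (iter_wreath ps)"
proof (induction ps rule: iter_wreath.induct)
  case 1
  show ?case by (simp add: group_image_group sym_group_is_group inj_def)
next
  case (2 p)
  show ?case by (simp add: group_image_group group_cyclic_perm_group inj_def)
next
  case (3 p q ps)
  then show ?case
    by (simp add: group_image_group group_wreath_product_cyclic inj_def del: One_nat_def)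
qed

lemma iter_wreath_single_iso: "cyclic_perm_group p \<cong> iter_wreath [p]"
  using inj_imp_image_group_iso[of Base "cyclic_perm_group p"]
  by (auto simp: is_iso_def inj_on_def)

lemma iter_wreath_Cons_iso:
  assumes "ps \<noteq> []"
  shows "wreath_product (iter_wreath ps) (cyclic_perm_group p) {1..p} (\<lambda>\<sigma>. \<sigma>) \<cong> iter_wreath (p # ps)"
  using assms inj_imp_image_group_iso[of Node
      "wreath_product (iter_wreath ps) (cyclic_perm_group p) {1..p} (\<lambda>\<sigma>. \<sigma>)"]
  by (cases ps) (auto simp: is_iso_def inj_on_def)

end

theory Submission
  imports Defs
begin

text \<open>In a wreath product \<open>H \<wr> C\<^sub>p\<close>, an element of the derived subgroup lies in the base group, say
  it is \<open>(f, 1)\<close>, and the product \<open>f\<^sub>p f\<^sub>1 \<dots> f\<^sub>p\<^sub>-\<^sub>1\<close> lies in \<open>H'\<close>, because multiplying all coordinates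
  modulo \<open>H'\<close> is a homomorphism to an abelian group. If this product is a single commutator
  \<open>[a, c]\<close>, then \<open>(f, 1)\<close> is a commutator \<open>[(\<alpha>, \<sigma>), (\<beta>, 1)]\<close>, where \<open>\<sigma>\<close> is the full cycle. So the
  property that all elements of the derived subgroup are commutators passes from \<open>H\<close> to
  \<open>H \<wr> C\<^sub>p\<close>. The width is not \<open>0\<close>, as \<open>H \<wr> C\<^sub>p\<close> is not abelian for nontrivial \<open>H\<close> and \<open>p \<ge> 2\<close>.\<close>

section \<open>Commutators, ordered products and maps to abelian groups\<close>

declare One_nat_def [simp del]

text \<open>Since \<open>derived_set\<close> generates the derived subgroup, this expresses that one
  commutator always suffices, that is, width at most 1. It is the invariant of the induction over
  the levels.\<close>

definition all_commutators :: "('a, 'b) monoid_scheme \<Rightarrow> bool"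
  where "all_commutators G \<longleftrightarrow> derived G (carrier G) \<subseteq> derived_set G (carrier G)"

text \<open>The order of factors matters in a nonabelian group, so \<open>finprod\<close> cannot
  serve. Indices start at 1 to match the coordinates \<open>{1..p}\<close>.\<close>

primrec partial_prod :: "('a, 'b) monoid_scheme \<Rightarrow> (nat \<Rightarrow> 'a) \<Rightarrow> nat \<Rightarrow> 'a"
  where
    "partial_prod G f 0 = \<one>\<^bsub>G\<^esub>"
  | "partial_prod G f (Suc n) = partial_prod G f n \<otimes>\<^bsub>G\<^esub> f (Suc n)"

lemma (in monoid) partial_prod_closed:
  "f \<in> {1..n} \<rightarrow> carrier G \<Longrightarrow> partial_prod G f n \<in> carrier G"
  by (induction n) (auto simp: Pi_iff)

text \<open>An abelian image forgets the order. This links the ordered product of the commutator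
  criterion to the unordered one that is invariant under permuting coordinates.\<close>

lemma hom_partial_prod:
  assumes "group G" "comm_group A" "h \<in> hom G A" "f \<in> {1..n} \<rightarrow> carrier G"
  shows "h (partial_prod G f n) = finprod A (\<lambda>i. h (f i)) {1..n}"
  using assms(4)
proof (induction n)
  interpret G: group G by fact
  interpret A: comm_group A by fact
  interpret h: group_hom G A h
    by (intro group_hom.intro group_hom_axioms.intro assms G.is_group A.is_group)
  case 0
  show ?case by simp
next
  interpret G: group G by fact
  interpret A: comm_group A by fact
  interpret h: group_hom G A h
    by (intro group_hom.intro group_hom_axioms.intro assms G.is_group A.is_group)
  case (Suc n)
  have f: "f \<in> {1..n} \<rightarrow> carrier G" "f (Suc n) \<in> carrier G"
    using Suc.prems by (auto simp: Pi_iff)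
  have "finprod A (\<lambda>i. h (f i)) {1..Suc n} = h (f (Suc n)) \<otimes>\<^bsub>A\<^esub> finprod A (\<lambda>i. h (f i)) {1..n}"
    using f by (subst atLeastAtMostSuc_conv) (auto simp: Pi_iff)
  moreover have "finprod A (\<lambda>i. h (f i)) {1..n} \<in> carrier A"
    using f by (auto intro!: A.finprod_closed simp: Pi_iff)
  ultimately show ?case
    using f Suc.IH G.partial_prod_closed[OF f(1)] by (simp add: A.m_comm)
qed

text \<open>The image of the derived subgroup is the derived subgroup of the image, which is trivial
  inside an abelian group.\<close>

lemma hom_derived_eq_one:
  assumes "group G" "comm_group A" "h \<in> hom G A" "x \<in> derived G (carrier G)"
  shows "h x = \<one>\<^bsub>A\<^esub>"
proof -
  interpret G: group G by fact
  interpret A: comm_group A by fact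
  interpret h: group_hom G A h
    by (intro group_hom.intro group_hom_axioms.intro assms G.is_group A.is_group)
  have "h ` derived G (carrier G) = {\<one>\<^bsub>A\<^esub>}"
    using h.derived_img[OF subset_refl] A.derived_eq_singleton[of "h ` carrier G"] h.hom_closed
    by (metis image_subsetI)
  then show ?thesis using assms(4) by blast
qed

text \<open>The form \<open>x b a = a b\<close> of \<open>x = [a, b]\<close> avoids computing
  inverses in a wreath product.\<close>

lemma (in group) derived_setI:
  assumes "a \<in> carrier G" "b \<in> carrier G" "x \<in> carrier G" "x \<otimes> (b \<otimes> a) = a \<otimes> b"
  shows "x \<in> derived_set G (carrier G)"
proof -
  have "x = a \<otimes> b \<otimes> inv (b \<otimes> a)"
    using assms by (metis inv_solve_right m_closed)
  also have "\<dots> = a \<otimes> b \<otimes> inv a \<otimes> inv b"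
    using assms by (simp add: inv_mult_group m_assoc)
  finally show ?thesis using assms by blast
qed

lemma (in group) derived_setE:
  assumes "x \<in> derived_set G (carrier G)"
  obtains a b where "a \<in> carrier G" "b \<in> carrier G" "x \<otimes> (b \<otimes> a) = a \<otimes> b"
proof -
  obtain a b where ab: "a \<in> carrier G" "b \<in> carrier G" "x = a \<otimes> b \<otimes> inv a \<otimes> inv b"
    using assms by blast
  have "x = a \<otimes> b \<otimes> inv (b \<otimes> a)"
    using ab by (simp add: inv_mult_group m_assoc)
  then have "x \<otimes> (b \<otimes> a) = a \<otimes> b"
    using ab by (metis inv_solve_right m_closed inv_closed)
  with ab that show thesis by blast
qed

section \<open>Transport along the constructors, and the width\<close>

lemma derived_image_group:
  assumes "group G" "inj f"
  shows "derived (image_group f G) (carrier (image_group f G)) = f ` derived G (carrier G)"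
proof -
  have "f \<in> iso G (image_group f G)"
    using assms(2) by (intro inj_imp_image_group_iso) (auto intro: inj_on_subset)
  then interpret f: group_hom G "image_group f G" f
    using assms group_image_group
    by (intro group_hom.intro group_hom_axioms.intro) (auto simp: iso_def)
  show ?thesis unfolding image_group_carrier by (rule f.derived_img) simp
qed

lemma all_commutators_image_group:
  assumes "group G" "inj f" "all_commutators G"
  shows "all_commutators (image_group f G)"
proof -
  interpret G: group G by fact
  interpret I: group "image_group f G" by (rule group_image_group[OF assms(1,2)])
  have "f \<in> iso G (image_group f G)"
    using assms(2) by (intro inj_imp_image_group_iso) (auto intro: inj_on_subset)
  then interpret f: group_hom G "image_group f G" f
    by (intro group_hom.intro group_hom_axioms.intro) (auto simp: iso_def)
  show ?thesis
    unfolding all_commutators_def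
  proof
    fix y assume "y \<in> derived (image_group f G) (carrier (image_group f G))"
    then obtain x where x: "x \<in> derived G (carrier G)" "y = f x"
      unfolding derived_image_group[OF assms(1,2)] by auto
    then have "x \<in> derived_set G (carrier G)"
      using assms(3) unfolding all_commutators_def by blast
    then obtain a b where ab: "a \<in> carrier G" "b \<in> carrier G"
      "x \<otimes>\<^bsub>G\<^esub> (b \<otimes>\<^bsub>G\<^esub> a) = a \<otimes>\<^bsub>G\<^esub> b"
      by (rule G.derived_setE)
    have xc: "x \<in> carrier G" using x G.derived_in_carrier by blast
    show "y \<in> derived_set (image_group f G) (carrier (image_group f G))"
    proof (rule I.derived_setI)
      show "y \<otimes>\<^bsub>image_group f G\<^esub> (f b \<otimes>\<^bsub>image_group f G\<^esub> f a) = f a \<otimes>\<^bsub>image_group f G\<^esub> f b"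
        using ab xc x(2) by (simp flip: f.hom_mult)
    qed (use ab xc x(2) in auto)
  qed
qed

lemma comm_group_all_commutators:
  assumes "comm_group G" shows "all_commutators G"
proof -
  interpret comm_group G by fact
  show ?thesis
    unfolding all_commutators_def derived_eq_singleton[OF subset_refl]
    using derived_setI[of "\<one>\<^bsub>G\<^esub>" "\<one>\<^bsub>G\<^esub>" "\<one>\<^bsub>G\<^esub>"] by simp
qed

text \<open>One-element lists give the upper bound; the nonidentity \<open>x\<close> excludes width
  0.\<close>

lemma commutator_width_eq_1:
  assumes "group G" "all_commutators G" "x \<in> derived G (carrier G)" "x \<noteq> \<one>\<^bsub>G\<^esub>"
  shows "commutator_width G = 1"
proof -
  interpret group G by fact
  have P: "\<exists>cs. length cs = 1 \<and> set cs \<subseteq> derived_set G (carrier G)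
      \<and> g = foldr (\<lambda>x y. x \<otimes>\<^bsub>G\<^esub> y) cs \<one>\<^bsub>G\<^esub>" if "g \<in> derived G (carrier G)" for g
  proof -
    have "g \<in> carrier G" using that derived_in_carrier by blast
    moreover have "g \<in> derived_set G (carrier G)"
      using that assms(2) unfolding all_commutators_def by blast
    ultimately show ?thesis by (intro exI[of _ "[g]"]) simp
  qed
  have le: "commutator_length G g \<le> 1" if "g \<in> derived G (carrier G)" for g
    unfolding commutator_length_def using P[OF that] by (rule Least_le)
  have "commutator_length G x \<noteq> 0"
  proof
    assume 0: "commutator_length G x = 0"
    \<comment> \<open>The least length is attained. If it were 0, the list would be empty and
      \<open>x\<close> the identity.\<close>
    have "\<exists>cs. length cs = commutator_length G x \<and> set cs \<subseteq> derived_set G (carrier G)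
      \<and> x = foldr (\<lambda>x y. x \<otimes>\<^bsub>G\<^esub> y) cs \<one>\<^bsub>G\<^esub>"
      unfolding commutator_length_def
      by (rule LeastI[where P = "\<lambda>n. \<exists>cs. length cs = n \<and> set cs \<subseteq> derived_set G (carrier G)
        \<and> x = foldr (\<lambda>x y. x \<otimes>\<^bsub>G\<^esub> y) cs \<one>\<^bsub>G\<^esub>", OF P[OF assms(3)]])
    with 0 assms(4) show False by auto
  qed
  with le[OF assms(3)] have "commutator_length G x = 1" by simp
  then show ?thesis
    unfolding commutator_width_def
    using le assms(3)
    by (intro antisym SUP_least SUP_upper2[of x]) (auto simp: one_enat_def)
qed

section \<open>The cyclic top group\<close>

lemma comm_group_cyclic_perm_group: "comm_group (cyclic_perm_group p)"
  using group_cyclic_perm_group unfolding cyclic_perm_group_def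
  by (rule group.cyclic_imp_abelian_group) (rule group.cyclic_group_generated[OF sym_group_is_group])

lemma cycle_in_cyclic_perm_group:
  "cycle_of_list [1..<Suc p] \<in> carrier (cyclic_perm_group p)"
proof -
  have "cycle_of_list [1..<Suc p] permutes set [1..<Suc p]"
    by (rule cycle_permutes)
  then have "cycle_of_list [1..<Suc p] permutes {1..p}"
    by (simp add: atLeastLessThanSuc_atLeastAtMost del: upt_Suc)
  then have "cycle_of_list [1..<Suc p] \<in> carrier (sym_group p)"
    by (simp add: sym_group_def del: upt_Suc)
  then show ?thesis
    unfolding cyclic_perm_group_def carrier_subgroup_generated
    by (auto intro: generate.incl simp del: upt_Suc)
qed

lemma inv_cyclic_perm_group_apply:
  assumes "\<sigma> \<in> carrier (cyclic_perm_group p)"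
  shows "(inv\<^bsub>cyclic_perm_group p\<^esub> \<sigma>) (\<sigma> x) = x"
  using group.l_inv[OF group_cyclic_perm_group assms]
  by (metis comp_apply cyclic_perm_group_mult cyclic_perm_group_one id_apply)

text \<open>\<open>permute_factors\<close> acts through the inverse, so after multiplication by the
  cycle coordinate \<open>x\<close> reads coordinate \<open>x - 1\<close>, and coordinate 1 reads
  \<open>p\<close>.\<close>

lemma inv_cycle_apply:
  assumes "x \<in> {1..p}"
  shows "(inv\<^bsub>cyclic_perm_group p\<^esub> (cycle_of_list [1..<Suc p])) x = (if x = 1 then p else x - 1)"
    (is "?\<tau> x = ?y")
proof -
  have "cycle_of_list [1..<Suc p] ?y = x"
    using assms by (subst cycle_apply) auto
  then show ?thesis
    using inv_cyclic_perm_group_apply[OF cycle_in_cyclic_perm_group, of p ?y] by simp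
qed

section \<open>The wreath step\<close>

abbreviation wreath_cyclic :: "('h, 'n) monoid_scheme \<Rightarrow> nat \<Rightarrow> ((nat \<Rightarrow> 'h) \<times> (nat \<Rightarrow> nat)) monoid"
  where "wreath_cyclic H p \<equiv> wreath_product H (cyclic_perm_group p) {1..p} (\<lambda>\<sigma>. \<sigma>)"

lemma carrier_wreath_cyclic:
  "carrier (wreath_cyclic H p) = ({1..p} \<rightarrow>\<^sub>E carrier H) \<times> carrier (cyclic_perm_group p)"
  by (simp add: wreath_product_def)

lemma inv_cyclic_perm_in:
  assumes "\<sigma> \<in> carrier (cyclic_perm_group p)" "x \<in> {1..p}"
  shows "(inv\<^bsub>cyclic_perm_group p\<^esub> \<sigma>) x \<in> {1..p}"
  using cyclic_perm_group_permutes[OF group.inv_closed[OF group_cyclic_perm_group assms(1)]] assms(2)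
  by (simp only: permutes_in_image)

lemma mult_wreath_cyclic:
  "(f, \<sigma>) \<otimes>\<^bsub>wreath_cyclic H p\<^esub> (g, \<tau>)
    = (\<lambda>x\<in>{1..p}. f x \<otimes>\<^bsub>H\<^esub> g ((inv\<^bsub>cyclic_perm_group p\<^esub> \<sigma>) x), \<sigma> \<circ> \<tau>)"
  by (auto simp: wreath_product_def permute_factors_def cyclic_perm_group_mult fun_eq_iff)

lemma inv_one_cyclic_perm_group: "inv\<^bsub>cyclic_perm_group p\<^esub> id = id"
  using group.is_monoid[OF group_cyclic_perm_group] monoid.inv_one cyclic_perm_group_one by metis

text \<open>Both conclusions come from homomorphisms to abelian groups: the projection to the top
  group, and the product of all coordinates after applying \<open>h\<close>.\<close>

lemma derived_wreath_cyclic: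
  assumes "group H" "comm_group A" "h \<in> hom H A"
    and "(f, \<sigma>) \<in> derived (wreath_cyclic H p) (carrier (wreath_cyclic H p))"
  shows "\<sigma> = id" "finprod A (\<lambda>i. h (f i)) {1..p} = \<one>\<^bsub>A\<^esub>"
proof -
  interpret H: group H by fact
  interpret A: comm_group A by fact
  interpret h: group_hom H A h
    by (intro group_hom.intro group_hom_axioms.intro assms H.is_group A.is_group)
  have W: "group (wreath_cyclic H p)" by (rule group_wreath_product_cyclic) fact
  have "snd \<in> hom (wreath_cyclic H p) (cyclic_perm_group p)"
    by (auto simp: hom_def carrier_wreath_cyclic mult_wreath_cyclic cyclic_perm_group_mult)
  from hom_derived_eq_one[OF W comm_group_cyclic_perm_group this assms(4)]
  show "\<sigma> = id" by (simp add: cyclic_perm_group_one)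
  let ?\<Phi> = "\<lambda>(f, \<sigma>). finprod A (\<lambda>i. h (f i)) {1..p}"
  have "?\<Phi> \<in> hom (wreath_cyclic H p) A"
  proof (rule homI)
    fix u assume "u \<in> carrier (wreath_cyclic H p)"
    then show "?\<Phi> u \<in> carrier A"
      by (auto simp: carrier_wreath_cyclic PiE_iff intro!: A.finprod_closed)
  next
    fix u v assume "u \<in> carrier (wreath_cyclic H p)" "v \<in> carrier (wreath_cyclic H p)"
    then obtain f \<sigma> g \<tau> where uv: "u = (f, \<sigma>)" "v = (g, \<tau>)"
      and f: "f \<in> {1..p} \<rightarrow> carrier H" and g: "g \<in> {1..p} \<rightarrow> carrier H"
      and \<sigma>: "\<sigma> \<in> carrier (cyclic_perm_group p)"
      by (auto simp: carrier_wreath_cyclic PiE_def)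
    let ?\<rho> = "inv\<^bsub>cyclic_perm_group p\<^esub> \<sigma>"
    have \<rho>: "?\<rho> permutes {1..p}"
      by (intro cyclic_perm_group_permutes group.inv_closed[OF group_cyclic_perm_group] \<sigma>)
    have g\<rho>: "g (?\<rho> i) \<in> carrier H" if "i \<in> {1..p}" for i
      using inv_cyclic_perm_in[OF \<sigma> that] g by blast
    \<comment> \<open>The action only permutes the coordinates of \<open>g\<close>, which a product
      in \<open>A\<close> does not notice; this makes the map multiplicative.\<close>
    have "finprod A (\<lambda>i. h (g i)) (?\<rho> ` {1..p}) = finprod A (\<lambda>i. h (g (?\<rho> i))) {1..p}"
      using g permutes_image[OF \<rho>] permutes_inj_on[OF \<rho>]
      by (intro A.finprod_reindex) (auto simp: Pi_iff)
    then have reindex: "finprod A (\<lambda>i. h (g (?\<rho> i))) {1..p} = finprod A (\<lambda>i. h (g i)) {1..p}"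
      by (simp only: permutes_image[OF \<rho>])
    have "?\<Phi> (u \<otimes>\<^bsub>wreath_cyclic H p\<^esub> v)
        = finprod A (\<lambda>i. h (f i) \<otimes>\<^bsub>A\<^esub> h (g (?\<rho> i))) {1..p}"
      unfolding uv mult_wreath_cyclic prod.case
      by (rule A.finprod_cong') (use f g\<rho> in \<open>auto simp: Pi_iff\<close>)
    also have "\<dots> = ?\<Phi> u \<otimes>\<^bsub>A\<^esub> ?\<Phi> v"
      using f g\<rho> by (subst A.finprod_multf) (auto simp: uv reindex Pi_iff)
    finally show "?\<Phi> (u \<otimes>\<^bsub>wreath_cyclic H p\<^esub> v) = ?\<Phi> u \<otimes>\<^bsub>A\<^esub> ?\<Phi> v" .
  qed
  from hom_derived_eq_one[OF W assms(2) this assms(4)]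
  show "finprod A (\<lambda>i. h (f i)) {1..p} = \<one>\<^bsub>A\<^esub>" by simp
qed

text \<open>The coordinate equations form one chain around the cycle. Coordinates 1 to
  \<open>p - 1\<close> accumulate the partial product, and closing the chain at \<open>p\<close>
  puts \<open>f p\<close> in front.\<close>

lemma wreath_cyclic_commutator:
  assumes "group H" "f \<in> {1..p} \<rightarrow>\<^sub>E carrier H" "p \<ge> 1"
    and "f p \<otimes>\<^bsub>H\<^esub> partial_prod H f (p - 1) \<in> derived_set H (carrier H)"
  shows "(f, id) \<in> derived_set (wreath_cyclic H p) (carrier (wreath_cyclic H p))"
proof -
  interpret H: group H by fact
  interpret W: group "wreath_cyclic H p" by (rule group_wreath_product_cyclic) fact
  let ?Q = "partial_prod H f"
  let ?\<sigma> = "cycle_of_list [1..<Suc p]"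
  obtain a c where ac: "a \<in> carrier H" "c \<in> carrier H"
    and eq: "f p \<otimes>\<^bsub>H\<^esub> ?Q (p - 1) \<otimes>\<^bsub>H\<^esub> (c \<otimes>\<^bsub>H\<^esub> a) = a \<otimes>\<^bsub>H\<^esub> c"
    using assms(4) by (rule H.derived_setE)
  have f: "f i \<in> carrier H" if "i \<in> {1..p}" for i using that assms(2) by blast
  have Q: "?Q i \<in> carrier H" if "i \<le> p" for i
    using that f by (intro H.partial_prod_closed) auto
  \<comment> \<open>Componentwise, \<open>(f, 1) (\<beta>, 1) (\<alpha>, \<sigma>) = (\<alpha>, \<sigma>) (\<beta>, 1)\<close> says \<open>f\<^sub>i \<beta>\<^sub>i \<alpha>\<^sub>i = \<alpha>\<^sub>i \<beta>\<^sub>i\<^sub>-\<^sub>1\<close>, indices modulo \<open>p\<close>.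
    With \<open>\<alpha>\<^sub>i = 1\<close> for \<open>i < p\<close> this determines \<open>\<beta>\<close> recursively from \<open>\<beta>\<^sub>p\<close>, and the last
    equation becomes \<open>f\<^sub>p f\<^sub>1 \<dots> f\<^sub>p\<^sub>-\<^sub>1 = [a, c]\<close>.\<close>
  define d where "d = ?Q (p - 1) \<otimes>\<^bsub>H\<^esub> c"
  have d: "d \<in> carrier H" using ac Q by (simp add: d_def)
  define \<alpha> where "\<alpha> = (\<lambda>i\<in>{1..p}. if i = p then a else \<one>\<^bsub>H\<^esub>)"
  \<comment> \<open>This solves \<open>f i * \<beta> i = \<beta> (i - 1)\<close> for
    \<open>i < p\<close>, started from \<open>d\<close> at the cyclic predecessor of 1. The choice
    of \<open>d\<close> makes the predecessor of \<open>p\<close> carry the value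
    \<open>c\<close>.\<close>
  define \<beta> where "\<beta> = (\<lambda>i\<in>{1..p}. if i = p then d else inv\<^bsub>H\<^esub> ?Q i \<otimes>\<^bsub>H\<^esub> d)"
  have carr: "(\<alpha>, ?\<sigma>) \<in> carrier (wreath_cyclic H p)" "(\<beta>, id) \<in> carrier (wreath_cyclic H p)"
    "(f, id) \<in> carrier (wreath_cyclic H p)"
    using ac d Q assms(2) cycle_in_cyclic_perm_group[of p]
      group.is_monoid[OF group_cyclic_perm_group] monoid.one_closed[of "cyclic_perm_group p"]
    by (auto simp: carrier_wreath_cyclic \<alpha>_def \<beta>_def cyclic_perm_group_one simp del: upt_Suc)
  have step: "f x \<otimes>\<^bsub>H\<^esub> (\<beta> x \<otimes>\<^bsub>H\<^esub> \<alpha> x) = \<alpha> x \<otimes>\<^bsub>H\<^esub> \<beta> (if x = 1 then p else x - 1)"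
    if x: "x \<in> {1..p}" for x
  proof -
    \<comment> \<open>As \<open>?Q 0\<close> is the identity, the formula also covers
      \<open>x = 1\<close>, whose predecessor is \<open>p\<close>.\<close>
    have prev: "\<beta> (if x = 1 then p else x - 1) = inv\<^bsub>H\<^esub> ?Q (x - 1) \<otimes>\<^bsub>H\<^esub> d"
      using x d assms(3) by (auto simp: \<beta>_def)
    have Qx: "?Q x = ?Q (x - 1) \<otimes>\<^bsub>H\<^esub> f x"
      using x by (cases x) auto
    have Q': "?Q (x - 1) \<in> carrier H" using x by (intro Q) auto
    show ?thesis
    proof (cases "x = p")
      case True
      have "inv\<^bsub>H\<^esub> ?Q (p - 1) \<otimes>\<^bsub>H\<^esub> d = c"
        using Q' True ac by (simp add: d_def flip: H.m_assoc)
      moreover have "f p \<otimes>\<^bsub>H\<^esub> (d \<otimes>\<^bsub>H\<^esub> a) = a \<otimes>\<^bsub>H\<^esub> c"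
        using eq Q' True ac f[OF x] by (simp add: d_def H.m_assoc)
      ultimately show ?thesis
        unfolding prev using True x by (simp add: \<alpha>_def \<beta>_def)
    next
      case False
      have "f x \<otimes>\<^bsub>H\<^esub> (inv\<^bsub>H\<^esub> ?Q x \<otimes>\<^bsub>H\<^esub> d) = inv\<^bsub>H\<^esub> ?Q (x - 1) \<otimes>\<^bsub>H\<^esub> d"
        unfolding Qx using Q' f[OF x] d by (simp add: H.inv_mult_group flip: H.m_assoc)
      then show ?thesis
        unfolding prev using False x Q' Q[of x] d by (simp add: \<alpha>_def \<beta>_def)
    qed
  qed
  show ?thesis
  proof (rule W.derived_setI[OF carr])
    \<comment> \<open>Both sides have the cycle as top component, so only the coordinate equations
      \<open>step\<close> remain.\<close>
    show "(f, id) \<otimes>\<^bsub>wreath_cyclic H p\<^esub> ((\<beta>, id) \<otimes>\<^bsub>wreath_cyclic H p\<^esub> (\<alpha>, ?\<sigma>))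
        = (\<alpha>, ?\<sigma>) \<otimes>\<^bsub>wreath_cyclic H p\<^esub> (\<beta>, id)"
      unfolding mult_wreath_cyclic inv_one_cyclic_perm_group
      using step by (auto simp: fun_eq_iff inv_cycle_apply simp del: upt_Suc)
  qed
qed

lemma all_commutators_wreath_cyclic:
  assumes "group H" "all_commutators H" "p \<ge> 1"
  shows "all_commutators (wreath_cyclic H p)"
proof -
  interpret H: group H by fact
  interpret W: group "wreath_cyclic H p" by (rule group_wreath_product_cyclic) fact
  let ?D = "derived H (carrier H)"
  interpret D: normal ?D H by (rule H.derived_self_is_normal)
  interpret A: comm_group "H Mod ?D" by (rule H.derived_quot_is_comm_group)
  \<comment> \<open>The quotient map is the right choice of \<open>h\<close> because its kernel is
    exactly the derived subgroup.\<close>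
  let ?h = "\<lambda>a. ?D #>\<^bsub>H\<^esub> a"
  have hom: "?h \<in> hom H (H Mod ?D)" by (rule D.r_coset_hom_Mod)
  show ?thesis
    unfolding all_commutators_def
  proof
    fix u assume u: "u \<in> derived (wreath_cyclic H p) (carrier (wreath_cyclic H p))"
    obtain f \<sigma> where fs: "u = (f, \<sigma>)" by fastforce
    have f: "f \<in> {1..p} \<rightarrow>\<^sub>E carrier H"
      using u W.derived_in_carrier[of "carrier (wreath_cyclic H p)"]
      by (auto simp: fs carrier_wreath_cyclic)
    note D = derived_wreath_cyclic[OF H.is_group A.comm_group_axioms hom u[unfolded fs]]
    let ?P = "partial_prod H f (p - 1)"
    have fp: "f p \<in> carrier H" using f assms(3) by auto
    have P: "?P \<in> carrier H" using f by (intro H.partial_prod_closed) auto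
    have "partial_prod H f p = ?P \<otimes>\<^bsub>H\<^esub> f p"
      using assms(3) by (cases p) auto
    then have "?h (?P \<otimes>\<^bsub>H\<^esub> f p) = \<one>\<^bsub>H Mod ?D\<^esub>"
      using hom_partial_prod[OF H.is_group A.comm_group_axioms hom, of f p] f D(2)
      by (auto simp: PiE_def)
    \<comment> \<open>The invariant controls \<open>f 1 ... f p\<close>, while the criterion has
      \<open>f p\<close> in front; modulo the derived subgroup the two orders agree.\<close>
    moreover have "?h (?P \<otimes>\<^bsub>H\<^esub> f p) = ?h (f p \<otimes>\<^bsub>H\<^esub> ?P)"
      using fp P A.m_comm[OF hom_in_carrier[OF hom fp] hom_in_carrier[OF hom P]]
      by (simp add: hom_mult[OF hom])
    ultimately have "?D #>\<^bsub>H\<^esub> (f p \<otimes>\<^bsub>H\<^esub> ?P) = ?D"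
      by simp
    then have "f p \<otimes>\<^bsub>H\<^esub> ?P \<in> ?D"
      using fp P D.subgroup_axioms by (metis H.m_closed H.rcos_self)
    then have "f p \<otimes>\<^bsub>H\<^esub> ?P \<in> derived_set H (carrier H)"
      using assms(2) unfolding all_commutators_def by blast
    from wreath_cyclic_commutator[OF H.is_group f assms(3) this]
    show "u \<in> derived_set (wreath_cyclic H p) (carrier (wreath_cyclic H p))"
      using fs D(1) by simp
  qed
qed

section \<open>Iteration and nontriviality\<close>

lemma all_commutators_iter_wreath:
  assumes "ps \<noteq> []" "\<forall>p\<in>set ps. p \<ge> 1"
  shows "all_commutators (iter_wreath ps)"
  using assms
proof (induction ps rule: iter_wreath.induct)
  case (2 p)
  show ?case
    by (simp add: all_commutators_image_group comm_group_all_commutators group_cyclic_perm_group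
        comm_group_cyclic_perm_group inj_def)
next
  case (3 p q ps)
  have "all_commutators (wreath_cyclic (iter_wreath (q # ps)) p)"
    using 3 by (intro all_commutators_wreath_cyclic group_iter_wreath) auto
  then show ?case
    unfolding iter_wreath.simps
    by (intro all_commutators_image_group group_wreath_product_cyclic group_iter_wreath)
      (auto simp: inj_def)
qed simp

text \<open>The full cycle of the head moves 1 to 2. With further factors it is paired with the
  trivial base function.\<close>

lemma iter_wreath_nontrivial:
  assumes "ps \<noteq> []" "hd ps \<ge> 2"
  shows "\<exists>x\<in>carrier (iter_wreath ps). x \<noteq> \<one>\<^bsub>iter_wreath ps\<^esub>"
proof -
  obtain p qs where ps: "ps = p # qs" "p \<ge> 2" using assms by (cases ps) auto
  let ?\<sigma> = "cycle_of_list [1..<Suc p]"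
  have "?\<sigma> 1 = 2" using ps by (subst cycle_apply) auto
  then have ne: "?\<sigma> \<noteq> id" by (auto simp del: upt_Suc)
  note \<sigma> = cycle_in_cyclic_perm_group[of p]
  show ?thesis
  proof (cases qs)
    case Nil
    with ne \<sigma> show ?thesis
      by (auto simp: ps image_group_carrier image_group_one cyclic_perm_group_one simp del: upt_Suc
          intro!: bexI[of _ ?\<sigma>])
  next
    case (Cons q rs)
    let ?H = "iter_wreath qs"
    interpret H: group ?H by (rule group_iter_wreath)
    let ?u = "(\<lambda>i\<in>{1..p}. \<one>\<^bsub>?H\<^esub>, ?\<sigma>)"
    have "?u \<in> carrier (wreath_cyclic ?H p)"
      using \<sigma> by (auto simp: carrier_wreath_cyclic simp del: upt_Suc)
    moreover have "?u \<noteq> \<one>\<^bsub>wreath_cyclic ?H p\<^esub>"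
      using ne by (auto simp: wreath_product_def cyclic_perm_group_one simp del: upt_Suc)
    ultimately show ?thesis
      unfolding ps Cons iter_wreath.simps image_group_carrier image_group_one by blast
  qed
qed

text \<open>The criterion for commutators is reused, on a nonidentity base element whose cyclic
  product is trivial.\<close>

lemma wreath_cyclic_derived_nontrivial:
  assumes "group H" "x \<in> carrier H" "x \<noteq> \<one>\<^bsub>H\<^esub>" "p \<ge> 2"
  shows "\<exists>u\<in>derived (wreath_cyclic H p) (carrier (wreath_cyclic H p)).
    u \<noteq> \<one>\<^bsub>wreath_cyclic H p\<^esub>"
proof -
  interpret H: group H by fact
  \<comment> \<open>The entries \<open>x\<close> and its inverse sit at the distinct coordinates 1
    and \<open>p\<close>, so they cancel in the product starting at \<open>f p\<close>.\<close>
  define f where "f = (\<lambda>i\<in>{1..p}. if i = 1 then x else if i = p then inv\<^bsub>H\<^esub> x else \<one>\<^bsub>H\<^esub>)"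
  have f: "f \<in> {1..p} \<rightarrow>\<^sub>E carrier H" using assms(2) by (auto simp: f_def)
  have "partial_prod H f n = x" if "1 \<le> n" "n < p" for n
    using that
  proof (induction n rule: nat_induct_at_least)
    case base
    then have "f 1 = x" by (simp add: f_def)
    then show ?case using assms(2) by (simp add: One_nat_def)
  next
    case (Suc n)
    then have "f (Suc n) = \<one>\<^bsub>H\<^esub>" by (simp add: f_def)
    with Suc assms(2) show ?case by simp
  qed
  then have "f p \<otimes>\<^bsub>H\<^esub> partial_prod H f (p - 1) = \<one>\<^bsub>H\<^esub>"
    using assms by (auto simp: f_def)
  moreover have "\<one>\<^bsub>H\<^esub> \<in> derived_set H (carrier H)"
    by (rule H.derived_setI[of "\<one>\<^bsub>H\<^esub>" "\<one>\<^bsub>H\<^esub>"]) auto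
  ultimately have "(f, id) \<in> derived_set (wreath_cyclic H p) (carrier (wreath_cyclic H p))"
    using wreath_cyclic_commutator[OF assms(1) f] assms(4) by simp
  then have "(f, id) \<in> derived (wreath_cyclic H p) (carrier (wreath_cyclic H p))"
    unfolding derived_def by (rule generate.incl)
  moreover have "f \<noteq> (\<lambda>i\<in>{1..p}. \<one>\<^bsub>H\<^esub>)"
    using assms(3,4) by (auto simp: f_def fun_eq_iff intro!: exI[of _ 1])
  then have "(f, id) \<noteq> \<one>\<^bsub>wreath_cyclic H p\<^esub>"
    by (auto simp: wreath_product_def)
  ultimately show ?thesis by blast
qed

theorem corollary6:
  fixes k :: nat and p :: "nat \<Rightarrow> nat"
  assumes "k \<ge> 2"
    and "\<And>i. 1 \<le> i \<Longrightarrow> i \<le> k \<Longrightarrow> p i \<ge> 2"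
  shows "commutator_width (iter_wreath (map p [1..<Suc k])) = 1"
proof -
  define qs where "qs = map p [3..<Suc k]"
  \<comment> \<open>Splitting off two entries selects the wreath clause of
    \<open>iter_wreath\<close>: \<open>p 1\<close> is the active factor, and \<open>p 2\<close>
    makes the base group nontrivial. The rest is empty for \<open>k = 2\<close>.\<close>
  have "[1..<Suc k] = 1 # 2 # [3..<Suc k]"
    using assms(1) by (simp add: upt_conv_Cons numeral_2_eq_2 numeral_3_eq_3 del: upt_Suc)
  then have ps: "map p [1..<Suc k] = p 1 # p 2 # qs"
    by (simp add: qs_def del: upt_Suc)
  let ?H = "iter_wreath (p 2 # qs)"
  have inj: "inj Node" by (auto simp: inj_def)
  have W: "group (wreath_cyclic ?H (p 1))"
    by (intro group_wreath_product_cyclic group_iter_wreath)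
  obtain x where x: "x \<in> carrier ?H" "x \<noteq> \<one>\<^bsub>?H\<^esub>"
    using iter_wreath_nontrivial[of "p 2 # qs"] assms by auto
  obtain u where u: "u \<in> derived (wreath_cyclic ?H (p 1)) (carrier (wreath_cyclic ?H (p 1)))"
    "u \<noteq> \<one>\<^bsub>wreath_cyclic ?H (p 1)\<^esub>"
    using wreath_cyclic_derived_nontrivial[OF group_iter_wreath x, of "p 1"] assms(1) assms(2)[of 1] by auto
  show ?thesis
  proof (rule commutator_width_eq_1)
    show "all_commutators (iter_wreath (map p [1..<Suc k]))"
      using assms by (intro all_commutators_iter_wreath) (fastforce simp del: upt_Suc)+
    show "Node u \<in> derived (iter_wreath (map p [1..<Suc k])) (carrier (iter_wreath (map p [1..<Suc k])))"
      unfolding ps iter_wreath.simps derived_image_group[OF W inj] using u by blast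
    show "Node u \<noteq> \<one>\<^bsub>iter_wreath (map p [1..<Suc k])\<^esub>"
      unfolding ps iter_wreath.simps image_group_one using u by simp
  qed (rule group_iter_wreath)
qed

end
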